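(* Let $\kappa$ be a measurable cardinal and $U$ a $\kappa$-complete $p$-point ultrafilter over $\kappa$, and for each $\alpha<\kappa$ let $U_\alpha$ be a $\delta_\alpha$-complete $p$-point ultrafilter over some ordinal $\delta_\alpha\le\kappa$. If $W\equiv_{RK}\sum_U U_\alpha$, then $W$ has the Galvin property: for every sequence $\langle A_i\mid i<\kappa^+\rangle$ of members of $W$ there is $I\in[\kappa^+]^\kappa$ with $\bigcap_{i\in I}A_i\in W$.
   Context: An ultrafilter $U$ over an ordinal $\delta$ is a $p$-point if for every $f:\delta\to\delta$ not constant mod $U$ there is $X\in U$ such that $f^{-1}[\gamma]\cap X$ is bounded in $\delta$ for every $\gamma<\delta$. The sum $\sum_U U_\alpha$ is the ultrafilter over $\kappa\times\kappa$: $X\in\sum_UU_\alpha$ iff $\{\alpha<\kappa\mid\{\beta<\delta_\alpha\mid\langle\alpha,\beta\rangle\in X\}\in U_\alpha\}\in U$. $U\le_{RK}W$ means there is a function $\pi$ with $U=\{B\mid\pi^{-1}[B]\in W\}$; $\equiv_{RK}$ means $\le_{RK}$ in both directions. *)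

theory Defs
  imports Main
begin

unbundle cardinal_syntax

text \<open>
  Ordinals are represented by well-orders \<open>s\<close>, with \<open>Field s\<close> playing the role of the set of
  smaller ordinals, and cardinals by the library's cardinal orders (\<open>Card_order\<close>).
  Given \<open>\<kappa>\<close> as a cardinal order \<open>r\<close>, the ordinals \<open>\<delta> \<le> \<kappa>\<close> correspond bijectively to the initial
  segments \<open>D\<close> of \<open>r\<close> (\<open>ofilter r D\<close>), where \<open>D\<close> is the set of ordinals below \<open>\<delta>\<close>
  and \<open>Restr r D\<close> is the associated well-order; \<open>D = Field r\<close> is \<open>\<delta> = \<kappa>\<close>.
\<close>

definition ultrafilter_on :: "'a set \<Rightarrow> 'a set set \<Rightarrow> bool" where
  "ultrafilter_on S U \<longleftrightarrow>
     U \<subseteq> Pow S \<and> S \<in> U \<and> {} \<notin> U \<and>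
     (\<forall>X\<in>U. \<forall>Y. X \<subseteq> Y \<and> Y \<subseteq> S \<longrightarrow> Y \<in> U) \<and>
     (\<forall>X\<in>U. \<forall>Y\<in>U. X \<inter> Y \<in> U) \<and>
     (\<forall>X. X \<subseteq> S \<longrightarrow> X \<in> U \<or> S - X \<in> U)"

definition nonprincipal_on :: "'a set \<Rightarrow> 'a set set \<Rightarrow> bool" where
  "nonprincipal_on S U \<longleftrightarrow> (\<forall>x\<in>S. {x} \<notin> U)"

text \<open>
  \<open>\<delta>\<close>-completeness for an ordinal \<open>\<delta>\<close> given by \<open>s\<close>: closure under intersections of fewer than \<open>\<delta>\<close>
  sets. As \<open><o\<close> compares well-orders, this is meaningful even if \<open>s\<close> is not a cardinal order:
  a family can be indexed by some \<open>\<beta> < \<delta>\<close> iff its cardinality is less than \<open>\<delta>\<close>.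
\<close>

definition complete_uf :: "'b rel \<Rightarrow> 'a set set \<Rightarrow> bool" where
  "complete_uf s U \<longleftrightarrow> (\<forall>F. F \<subseteq> U \<and> F \<noteq> {} \<and> |F| <o s \<longrightarrow> \<Inter>F \<in> U)"

definition measurable_cardinal :: "'a rel \<Rightarrow> bool" where
  "measurable_cardinal r \<longleftrightarrow>
     Card_order r \<and> natLeq <o r \<and>
     (\<exists>U. ultrafilter_on (Field r) U \<and> nonprincipal_on (Field r) U \<and> complete_uf r U)"

definition constant_mod :: "'a rel \<Rightarrow> 'a set set \<Rightarrow> ('a \<Rightarrow> 'a) \<Rightarrow> bool" where
  "constant_mod s U f \<longleftrightarrow> (\<exists>c\<in>Field s. {x \<in> Field s. f x = c} \<in> U)"

definition bounded_in :: "'a rel \<Rightarrow> 'a set \<Rightarrow> bool" where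
  "bounded_in s Y \<longleftrightarrow> (\<exists>b\<in>Field s. \<forall>y\<in>Y. (y, b) \<in> s)"

text \<open>
  The preimage \<open>f\<inverse>[\<gamma>]\<close> is that of the ordinal \<open>\<gamma>\<close> viewed as the set \<open>underS s \<gamma>\<close> of its elements.
  Principal ultrafilters are not excluded; they satisfy the condition vacuously.
\<close>

definition p_point :: "'a rel \<Rightarrow> 'a set set \<Rightarrow> bool" where
  "p_point s U \<longleftrightarrow>
     ultrafilter_on (Field s) U \<and>
     (\<forall>f. f ` Field s \<subseteq> Field s \<and> \<not> constant_mod s U f \<longrightarrow>
        (\<exists>X\<in>U. \<forall>\<gamma>\<in>Field s. bounded_in s {x \<in> X. f x \<in> underS s \<gamma>}))"

definition sum_uf :: "'a rel \<Rightarrow> 'a set set \<Rightarrow> ('a \<Rightarrow> 'a set) \<Rightarrow> ('a \<Rightarrow> 'a set set) \<Rightarrow> ('a \<times> 'a) set set"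
  where
  "sum_uf r U \<delta> V =
     {X. X \<subseteq> Field r \<times> Field r \<and> {\<alpha> \<in> Field r. {\<beta> \<in> \<delta> \<alpha>. (\<alpha>, \<beta>) \<in> X} \<in> V \<alpha>} \<in> U}"

text \<open>Rudin--Keisler order and equivalence for \<open>U\<close> over the set \<open>S\<close> and \<open>W\<close> over the set \<open>T\<close>.\<close>

definition rk_le :: "'a set \<Rightarrow> 'a set set \<Rightarrow> 'b set \<Rightarrow> 'b set set \<Rightarrow> bool" where
  "rk_le S U T W \<longleftrightarrow>
     (\<exists>\<pi>. \<pi> ` T \<subseteq> S \<and> U = {B. B \<subseteq> S \<and> {t \<in> T. \<pi> t \<in> B} \<in> W})"

definition rk_equiv :: "'a set \<Rightarrow> 'a set set \<Rightarrow> 'b set \<Rightarrow> 'b set set \<Rightarrow> bool" where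
  "rk_equiv S U T W \<longleftrightarrow> rk_le S U T W \<and> rk_le T W S U"

text \<open>The cardinal \<open>\<kappa>\<^sup>+\<close> is \<open>cardSuc r\<close>, so its elements are those of \<open>Field (cardSuc r)\<close>.\<close>

definition galvin_property :: "'a rel \<Rightarrow> 'b set set \<Rightarrow> bool" where
  "galvin_property r W \<longleftrightarrow>
     (\<forall>A. (\<forall>i\<in>Field (cardSuc r). A i \<in> W) \<longrightarrow>
        (\<exists>I. I \<subseteq> Field (cardSuc r) \<and> |I| =o r \<and> (\<Inter>i\<in>I. A i) \<in> W))"

end

theory Submission
  imports Defs
begin

text \<open>
  Let \<open>\<pi>\<close> be a least function that is not constant mod \<open>U\<close>: every function below it is constant on a
  set of \<open>U\<close>, so \<open>U\<close> is closed under the diagonal intersections \<open>{\<alpha>. \<forall>\<xi> < \<pi> \<alpha>. \<alpha> \<in> B \<xi>}\<close>, and the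
  \<open>p\<close>-point property bounds the sets \<open>{\<alpha> \<in> X. \<pi> \<alpha> \<le> \<xi>}\<close> for some \<open>X \<in> U\<close>. Choose \<open>\<pi>\<^sub>\<alpha>\<close>, \<open>X\<^sub>\<alpha>\<close> for
  \<open>U\<^sub>\<alpha>\<close> in the same way. As \<open>\<kappa>\<close> is inaccessible, there are an index \<open>i\<close> and distinct \<open>j \<xi>\<close>,
  \<open>\<xi> < \<kappa>\<close>, such that \<open>A (j \<xi>)\<close> and \<open>A i\<close> share prescribed data of size less than \<open>\<kappa>\<close> depending
  on \<open>\<xi>\<close>. For almost all \<open>(\<alpha>, \<beta>) \<in> A i\<close>, membership in \<open>A (j \<xi>)\<close> comes from a diagonal intersection
  if \<open>\<xi> < \<pi>\<^sub>\<alpha> \<beta>\<close>, and from the shared data if \<open>\<xi> \<ge> \<pi>\<^sub>\<alpha> \<beta>\<close> and \<open>\<xi> \<ge> \<pi> \<alpha>\<close>. In the remaining case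
  \<open>\<pi>\<^sub>\<alpha> \<beta> \<le> \<xi> < \<pi> \<alpha>\<close> one uses completeness of \<open>U\<^sub>\<alpha>\<close> if \<open>\<pi> \<alpha> < \<delta>\<^sub>\<alpha>\<close>. Otherwise the bound on
  \<open>{\<beta> \<in> X\<^sub>\<alpha>. \<pi>\<^sub>\<alpha> \<beta> \<le> \<xi>}\<close> lies below \<open>\<pi> \<alpha>\<close>, hence does not depend on \<open>\<alpha>\<close>, and agreement of the sections
  up to that bound for almost all \<open>\<alpha>\<close> is again part of the shared data.
\<close>

section \<open>Ultrafilters as "almost all" quantifiers\<close>

lemma uf_mono:
  assumes "ultrafilter_on S U" "X \<in> U" "\<And>x. x \<in> S \<Longrightarrow> x \<in> X \<Longrightarrow> P x"
  shows "{x \<in> S. P x} \<in> U"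
proof -
  have "X \<subseteq> {x \<in> S. P x}"
    using assms unfolding ultrafilter_on_def by auto
  then show ?thesis
    using assms(1,2) unfolding ultrafilter_on_def by auto
qed

lemma uf_conj:
  assumes "ultrafilter_on S U" "{x \<in> S. P x} \<in> U" "{x \<in> S. Q x} \<in> U"
  shows "{x \<in> S. P x \<and> Q x} \<in> U"
proof -
  have "{x \<in> S. P x} \<inter> {x \<in> S. Q x} \<in> U"
    using assms unfolding ultrafilter_on_def by blast
  then show ?thesis
    by (rule uf_mono[OF assms(1)]) auto
qed

lemma uf_not:
  assumes "ultrafilter_on S U"
  shows "{x \<in> S. \<not> P x} \<in> U \<longleftrightarrow> {x \<in> S. P x} \<notin> U"
proof
  assume "{x \<in> S. \<not> P x} \<in> U"
  then show "{x \<in> S. P x} \<notin> U"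
    using uf_conj[OF assms, of "\<lambda>x. \<not> P x" P] assms unfolding ultrafilter_on_def by auto
next
  assume "{x \<in> S. P x} \<notin> U"
  then have "S - {x \<in> S. P x} \<in> U"
    using assms unfolding ultrafilter_on_def by (metis (no_types, lifting) mem_Collect_eq subsetI)
  then show "{x \<in> S. \<not> P x} \<in> U"
    by (rule uf_mono[OF assms]) auto
qed

lemma uf_ex:
  assumes "ultrafilter_on S U" "{x \<in> S. P x} \<in> U"
  obtains x where "x \<in> S" "P x"
proof -
  have "{x \<in> S. P x} \<noteq> {}"
    using assms unfolding ultrafilter_on_def by metis
  then show ?thesis using that by blast
qed

lemma uf_carrier: "ultrafilter_on S U \<Longrightarrow> S \<in> U"
  unfolding ultrafilter_on_def by blast

lemma uf_Ball:
  assumes U: "ultrafilter_on S U" "complete_uf s U"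
    and I: "|I| <o s" and P: "\<And>i. i \<in> I \<Longrightarrow> {x \<in> S. P i x} \<in> U"
  shows "{x \<in> S. \<forall>i\<in>I. P i x} \<in> U"
proof (cases "I = {}")
  case True
  then show ?thesis using uf_carrier[OF U(1)] by auto
next
  case False
  let ?F = "(\<lambda>i. {x \<in> S. P i x}) ` I"
  have F: "|?F| <o s"
    by (rule ordLeq_ordLess_trans[OF card_of_image I])
  have "\<Inter> ?F \<in> U"
    by (rule U(2)[unfolded complete_uf_def, rule_format]) (use False P F in auto)
  then show ?thesis
    by (rule uf_mono[OF U(1)]) auto
qed

section \<open>Sizes of initial segments\<close>

lemma card_underS_Restr:
  assumes "Well_order s"
  shows "|underS s m| \<le>o Restr s (underS s m)"
  by (rule card_of_least) (use assms in \<open>auto intro!: well_order_on_Restr simp: underS_Field\<close>)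

text \<open>As \<open>s\<close> need not be a cardinal order, the comparison passes through the
  order type of the segment, which bounds its cardinality and is less than \<open>s\<close>.\<close>

lemma card_underS_less:
  assumes "Well_order s" "m \<in> Field s"
  shows "|underS s m| <o s"
  by (rule ordLeq_ordLess_trans[OF card_underS_Restr[OF assms(1)] underS_Restr_ordLess[OF assms(1)]])
    (use assms(2) in blast)

lemma underS_iff:
  assumes "Well_order s" "x \<in> Field s" "y \<in> Field s"
  shows "x \<in> underS s y \<longleftrightarrow> (y, x) \<notin> s"
proof -
  interpret w: wo_rel s using assms by (simp add: wo_rel_def)
  show ?thesis
    unfolding underS_def using assms w.TOTALS w.ANTISYM w.REFL
    by (auto simp: antisym_def refl_on_def)
qed

lemma Well_order_least:
  assumes "Well_order s" "Field s \<noteq> {}"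
  shows "\<exists>z\<in>Field s. underS s z = {}"
proof -
  interpret w: wo_rel s using assms by (simp add: wo_rel_def)
  obtain z where "w.isMinim (Field s) z"
    using w.Well_order_isMinim_exists[of "Field s"] assms(2) by blast
  then have "z \<in> Field s" "underS s z = {}"
    unfolding w.isMinim_def underS_def using w.ANTISYM by (auto simp: antisym_def Field_def)
  then show ?thesis by blast
qed

lemma infinite_Field:
  assumes "Card_order r" "natLeq <o r"
  shows "\<not> finite (Field r)"
proof -
  have "natLeq \<le>o |Field r|"
    by (rule ordLeq_ordIso_trans[OF ordLess_imp_ordLeq[OF assms(2)]
          ordIso_symmetric[OF card_of_Field_ordIso[OF assms(1)]]])
  then show ?thesis using infinite_iff_natLeq_ordLeq by blast
qed

lemma card_under_less:
  assumes "Card_order r" "natLeq <o r" "b \<in> Field r"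
  shows "|under r b| <o r"
proof -
  have "\<not> finite (Field r)"
    by (rule infinite_Field[OF assms(1,2)])
  then obtain c where c: "c \<in> Field r" "b \<noteq> c" "(b, c) \<in> r"
    using infinite_Card_order_limit assms by metis
  have "Well_order r" using assms(1) by (simp add: card_order_on_well_order_on)
  then interpret w: wo_rel r by (simp add: wo_rel_def)
  have "under r b \<subseteq> underS r c"
    using c w.TRANS w.ANTISYM unfolding under_def underS_def trans_def antisym_def by blast
  then show ?thesis
    using card_of_mono1 card_of_underS[OF assms(1) c(1)] ordLeq_ordLess_trans by blast
qed

section \<open>Inaccessibility of measurable cardinals\<close>

lemma small_measure_zero:
  assumes U: "ultrafilter_on S U" "nonprincipal_on S U" "complete_uf s U" and "|Y| <o s"
  shows "{x \<in> S. x \<notin> Y} \<in> U"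
proof -
  have "{x \<in> S. \<forall>y\<in>Y. x \<noteq> y} \<in> U"
  proof (rule uf_Ball[OF U(1,3) \<open>|Y| <o s\<close>])
    fix y
    have "{x \<in> S. x = y} \<notin> U"
    proof (cases "y \<in> S")
      case True
      then have "{x \<in> S. x = y} = {y}" by auto
      then show ?thesis using U(2) True unfolding nonprincipal_on_def by simp
    next
      case False
      then have "{x \<in> S. x = y} = {}" by auto
      then show ?thesis using U(1) unfolding ultrafilter_on_def by metis
    qed
    then show "{x \<in> S. x \<noteq> y} \<in> U" using uf_not[OF U(1), of "\<lambda>x. x = y"] by simp
  qed
  then show ?thesis by (rule uf_mono[OF U(1)]) auto
qed

lemma not_less_imp_card_Field_le:
  assumes "Card_order r" "\<not> |A| <o r"
  shows "|Field r| \<le>o |A|"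
proof -
  have "r \<le>o |A|"
    using assms by (simp add: not_ordLess_iff_ordLeq[symmetric] card_of_Well_order card_order_on_well_order_on)
  then show ?thesis
    by (rule ordIso_ordLeq_trans[OF card_of_Field_ordIso[OF assms(1)]])
qed

text \<open>The strong limit half of inaccessibility. By completeness an injection of \<kappa> into
  \<open>Pow Y\<close> would be constant on a set in \<open>M\<close>, hence on a singleton,
  contrary to nonprincipality.\<close>

lemma measurable_card_Pow:
  assumes "measurable_cardinal r" and Y: "|Y| <o r"
  shows "|Pow Y| <o r"
proof (rule ccontr)
  assume *: "\<not> |Pow Y| <o r"
  obtain M where r: "Card_order r" "natLeq <o r"
    and M: "ultrafilter_on (Field r) M" "nonprincipal_on (Field r) M" "complete_uf r M"
    using assms(1) unfolding measurable_cardinal_def by (elim conjE exE)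
  have "|Field r| \<le>o |Pow Y|"
    by (rule not_less_imp_card_Field_le[OF r(1) *])
  then obtain g where g: "inj_on g (Field r)" "g ` Field r \<subseteq> Pow Y"
    unfolding card_of_ordLeq[symmetric] by (elim exE conjE)
  \<comment> \<open>The majority value of \<open>g\<close>: completeness makes \<open>g\<close> equal to it on a set in \<open>M\<close>.\<close>
  define Z where "Z = {y. {x \<in> Field r. y \<in> g x} \<in> M}"
  have "{x \<in> Field r. \<forall>y\<in>Y. y \<in> g x \<longleftrightarrow> y \<in> Z} \<in> M"
  proof (rule uf_Ball[OF M(1,3) Y])
    fix y
    show "{x \<in> Field r. y \<in> g x \<longleftrightarrow> y \<in> Z} \<in> M"
      using uf_not[OF M(1), of "\<lambda>x. y \<in> g x"] by (cases "y \<in> Z") (auto simp: Z_def)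
  qed
  then have Q: "{x \<in> Field r. g x = Y \<inter> Z} \<in> M"
    by (rule uf_mono[OF M(1)]) (use g(2) in blast)
  then obtain c where c: "c \<in> Field r" "g c = Y \<inter> Z"
    by (rule uf_ex[OF M(1)])
  have "{x \<in> Field r. g x = Y \<inter> Z} = {c}"
    using c g(1) by (auto simp: inj_on_def)
  then show False
    using Q M(2) c(1) unfolding nonprincipal_on_def by simp
qed

text \<open>The regularity half of inaccessibility. An injection of \<kappa> into the sum would
  split \<kappa> by first coordinate into fewer than \<kappa> pieces; each embeds into some
  \<open>B a\<close>, so it has measure zero, and completeness would leave nothing.\<close>

lemma measurable_card_Sigma:
  assumes "measurable_cardinal r" and A: "|A| <o r" and B: "\<And>a. a \<in> A \<Longrightarrow> |B a| <o r"
  shows "|Sigma A B| <o r"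
proof (rule ccontr)
  assume *: "\<not> |Sigma A B| <o r"
  obtain M where r: "Card_order r" "natLeq <o r"
    and M: "ultrafilter_on (Field r) M" "nonprincipal_on (Field r) M" "complete_uf r M"
    using assms(1) unfolding measurable_cardinal_def by (elim conjE exE)
  have "|Field r| \<le>o |Sigma A B|"
    by (rule not_less_imp_card_Field_le[OF r(1) *])
  then obtain g where g: "inj_on g (Field r)" "g ` Field r \<subseteq> Sigma A B"
    unfolding card_of_ordLeq[symmetric] by (elim exE conjE)
  have "{x \<in> Field r. \<forall>a\<in>A. x \<notin> {x \<in> Field r. fst (g x) = a}} \<in> M"
  proof (rule uf_Ball[OF M(1,3) A], rule small_measure_zero[OF M])
    fix a assume a: "a \<in> A"
    let ?Y = "{x \<in> Field r. fst (g x) = a}"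
    have "inj_on (snd \<circ> g) ?Y"
      using g(1) by (auto simp: inj_on_def prod_eq_iff)
    moreover have "(snd \<circ> g) ` ?Y \<subseteq> B a"
      using g(2) by fastforce
    ultimately have "|?Y| \<le>o |B a|"
      unfolding card_of_ordLeq[symmetric] by (intro exI conjI)
    then show "|?Y| <o r" by (rule ordLeq_ordLess_trans[OF _ B[OF a]])
  qed
  then obtain x where "x \<in> Field r" "\<forall>a\<in>A. x \<notin> {x \<in> Field r. fst (g x) = a}"
    by (rule uf_ex[OF M(1)])
  moreover have "g x \<in> Sigma A B" using g(2) \<open>x \<in> Field r\<close> by blast
  ultimately show False by auto
qed

section \<open>Many indices resembling a single one\<close>

text \<open>Recursion along \<open>r\<close>: at stage \<open>x\<close> fewer than \<kappa> values
  are taken, too few to exhaust \<open>C x\<close>.\<close>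

lemma injective_choice:
  assumes "Card_order r" and C: "\<And>x. x \<in> Field r \<Longrightarrow> \<not> |C x| \<le>o r"
  obtains j where "inj_on j (Field r)" "\<And>x. x \<in> Field r \<Longrightarrow> j x \<in> C x"
proof -
  have W: "Well_order r" using assms(1) by (simp add: card_order_on_well_order_on)
  then interpret w: wo_rel r by (simp add: wo_rel_def)
  define H where "H f x = (SOME y. y \<in> C x - f ` underS r x)" for f x
  define j where "j = w.worec H"
  have "w.adm_wo H"
    unfolding w.adm_wo_def
  proof clarify
    fix f g :: "'a \<Rightarrow> 'b" and x assume "\<forall>y\<in>underS r x. f y = g y"
    then have "f ` underS r x = g ` underS r x" by auto
    then show "H f x = H g x" unfolding H_def by simp
  qed
  then have fix_j: "j x = H j x" for x
    unfolding j_def by (subst w.worec_fixpoint) simp_all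
  have j: "j x \<in> C x - j ` underS r x" if x: "x \<in> Field r" for x
  proof -
    have "|j ` underS r x| \<le>o r"
      by (rule ordLess_imp_ordLeq[OF ordLeq_ordLess_trans[OF card_of_image card_of_underS[OF assms(1) x]]])
    then have "\<not> C x \<subseteq> j ` underS r x"
      using C[OF x] ordLeq_transitive[OF card_of_mono1] by metis
    then show ?thesis
      using someI_ex[of "\<lambda>y. y \<in> C x - j ` underS r x"] fix_j[of x] unfolding H_def by auto
  qed
  have "inj_on j (Field r)"
  proof (rule inj_onI)
    fix x y assume xy: "x \<in> Field r" "y \<in> Field r" "j x = j y"
    then have "x \<notin> underS r y" "y \<notin> underS r x"
      using j[OF xy(1)] j[OF xy(2)] by (metis DiffD2 imageI)+
    then show "x = y"
      using xy underS_iff[OF W] by (auto simp: underS_def)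
  qed
  with j that show ?thesis by blast
qed

text \<open>Discard every index that lies, for some \<open>x\<close>, in a fibre of
  \<open>c x\<close> of size at most \<kappa>. These fibres number at most \<kappa>, so at most
  \<kappa> indices are lost and some \<open>i\<close> survives; its fibres are large enough for
  \<open>injective_choice\<close>.\<close>

lemma cardSuc_pigeonhole:
  assumes r: "Card_order r" "natLeq <o r"
    and c: "\<And>x. x \<in> Field r \<Longrightarrow> |c x ` Field (cardSuc r)| \<le>o r"
  shows "\<exists>i\<in>Field (cardSuc r). \<exists>j. inj_on j (Field r) \<and>
    (\<forall>x\<in>Field r. j x \<in> Field (cardSuc r) \<and> c x (j x) = c x i)"
proof -
  let ?F = "Field (cardSuc r)"
  define H where "H x v = {j \<in> ?F. c x j = v}" for x v
  have inf: "\<not> finite (Field r)"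
    by (rule infinite_Field[OF r])
  have Fr: "r =o |Field r|"
    by (rule ordIso_symmetric[OF card_of_Field_ordIso[OF r(1)]])
  have "\<exists>i\<in>?F. \<forall>x\<in>Field r. \<not> |H x (c x i)| \<le>o r"
  proof (rule ccontr)
    assume "\<not> ?thesis"
    then have "?F \<subseteq> (\<Union>x\<in>Field r. \<Union>v\<in>{v \<in> c x ` ?F. |H x v| \<le>o r}. H x v)" (is "_ \<subseteq> ?G")
      by (auto simp: H_def)
    moreover have "|?G| \<le>o |Field r|"
    proof (intro card_of_UNION_ordLeq_infinite[OF inf] ballI)
      show "|Field r| \<le>o |Field r|" by (rule ordLeq_refl[OF card_of_Card_order])
      fix x assume "x \<in> Field r"
      then have "|c x ` ?F| \<le>o |Field r|" by (rule ordLeq_ordIso_trans[OF c Fr])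
      then show "|{v \<in> c x ` ?F. |H x v| \<le>o r}| \<le>o |Field r|"
        by (rule ordLeq_transitive[OF card_of_mono1, rotated]) blast
      fix v assume "v \<in> {v \<in> c x ` ?F. |H x v| \<le>o r}"
      then have "|H x v| \<le>o r" by blast
      then show "|H x v| \<le>o |Field r|" by (rule ordLeq_ordIso_trans[OF _ Fr])
    qed
    ultimately have "|?F| \<le>o |Field r|" by (rule ordLeq_transitive[OF card_of_mono1])
    then have "|?F| \<le>o r" by (rule ordLeq_ordIso_trans[OF _ card_of_Field_ordIso[OF r(1)]])
    with card_of_Field_ordIso[OF cardSuc_Card_order[OF r(1)]] have "cardSuc r \<le>o r"
      by (rule ordIso_ordLeq_trans[OF ordIso_symmetric])
    then show False
      using cardSuc_greater[OF r(1)] not_ordLess_ordLeq by blast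
  qed
  then obtain i where i: "i \<in> ?F" "\<And>x. x \<in> Field r \<Longrightarrow> \<not> |H x (c x i)| \<le>o r"
    by blast
  obtain j where "inj_on j (Field r)" "\<And>x. x \<in> Field r \<Longrightarrow> j x \<in> H x (c x i)"
    using injective_choice[OF r(1), of "\<lambda>x. H x (c x i)"] i(2) by blast
  with i(1) show ?thesis unfolding H_def by blast
qed

section \<open>Least nonconstant functions and diagonal intersections\<close>

lemma complete_nonprincipal_no_max:
  assumes s: "Well_order s" and V: "ultrafilter_on (Field s) V" "nonprincipal_on (Field s) V"
    "complete_uf s V" and m: "m \<in> Field s"
  shows "\<exists>m'\<in>Field s. m \<in> underS s m'"
proof (rule ccontr)
  assume *: "\<not> ?thesis"
  have max: "x = m" if "x \<in> Field s" "x \<notin> underS s m" for x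
  proof (rule ccontr)
    assume "x \<noteq> m"
    then have "m \<in> underS s x"
      using underS_iff[OF s that(1) m] that(2) unfolding underS_def by auto
    then show False using * that by blast
  qed
  have "{x \<in> Field s. x \<notin> underS s m} \<in> V"
    by (rule small_measure_zero[OF V card_underS_less[OF s m]])
  then have "{x \<in> Field s. x = m} \<in> V"
    by (rule uf_mono[OF V(1)]) (use max in blast)
  moreover have "{x \<in> Field s. x = m} = {m}" using m by auto
  ultimately show False using V(2) m unfolding nonprincipal_on_def by simp
qed

text \<open>Well-foundedness of the ultrapower: \<open>natLeq <o s\<close> gives closure under
  countable intersections, so a descending sequence of functions would descend at a single
  point.\<close>

lemma wf_less_mod_ultrafilter:
  assumes s: "Well_order s" and V: "ultrafilter_on S V" "complete_uf s V" "natLeq <o s"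
  shows "wf {(f, g). {x \<in> S. f x \<in> underS s (g x)} \<in> V}"
  unfolding wf_iff_no_infinite_down_chain
proof clarify
  fix f assume f: "\<forall>i. (f (Suc i), f i) \<in> {(f, g). {x \<in> S. f x \<in> underS s (g x)} \<in> V}"
  have "|UNIV :: nat set| <o s"
    using card_of_nat V(3) ordIso_ordLess_trans by blast
  then have "{x \<in> S. \<forall>i\<in>UNIV. f (Suc i) x \<in> underS s (f i x)} \<in> V"
    by (rule uf_Ball[OF V(1,2)]) (use f in simp)
  then obtain x where "\<forall>i\<in>UNIV. f (Suc i) x \<in> underS s (f i x)"
    by (rule uf_ex[OF V(1)])
  then have "(f (Suc i) x, f i x) \<in> s - Id" for i
    unfolding underS_def by blast
  moreover have "wf (s - Id)" using s unfolding well_order_on_def by blast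
  ultimately show False
    using wf_no_infinite_down_chainE[of "s - Id" "\<lambda>i. f i x"] by blast
qed

text \<open>The nonstrict comparison makes this the complementary case, within \<open>X\<close>, to
  \<xi> lying strictly below \<open>p \<beta>\<close>, which diagonal intersections treat.\<close>

definition lower_part :: "'a rel \<Rightarrow> ('b \<Rightarrow> 'a) \<Rightarrow> 'b set \<Rightarrow> 'a \<Rightarrow> 'b set" where
  "lower_part r p X \<xi> = {\<beta> \<in> X. (p \<beta>, \<xi>) \<in> r}"

text \<open>For \<open>p = id\<close> this is normality; in general every function below \<open>p\<close> is constant mod \<open>V\<close>.\<close>
definition diagonal_closed :: "'a rel \<Rightarrow> ('b \<Rightarrow> 'a) \<Rightarrow> 'b set \<Rightarrow> 'b set set \<Rightarrow> bool" where
  "diagonal_closed r p S V \<longleftrightarrow>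
     (\<forall>B. (\<forall>\<xi>\<in>Field r. B \<xi> \<in> V) \<longrightarrow> {x \<in> S. \<forall>\<xi>\<in>underS r (p x). x \<in> B \<xi>} \<in> V)"

lemma diagonal_closedD:
  assumes "diagonal_closed r p S V" "\<And>\<xi>. \<xi> \<in> Field r \<Longrightarrow> B \<xi> \<in> V"
  shows "{x \<in> S. \<forall>\<xi>\<in>underS r (p x). x \<in> B \<xi>} \<in> V"
  using assms(1)[unfolded diagonal_closed_def, THEN spec, of B] assms(2) by simp

text \<open>The last conjunct will place \<pi> above \<omega>; its alternative
  \<open>underS s (\<pi> x) = {}\<close> accommodates principal \<open>V\<close>, where \<pi> is
  constantly the least element.\<close>

lemma p_point_projection:
  assumes s: "Well_order s" and P: "p_point s V" and C: "complete_uf s V"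
    and unctbl: "nonprincipal_on (Field s) V \<longrightarrow> natLeq <o s"
  shows "\<exists>\<pi> X. \<pi> ` Field s \<subseteq> Field s \<and> X \<in> V \<and> diagonal_closed s \<pi> (Field s) V \<and>
    (\<forall>\<xi>\<in>Field s. bounded_in s (lower_part s \<pi> X \<xi>)) \<and>
    (\<forall>\<gamma>\<in>Field s. {x \<in> Field s. underS s (\<pi> x) = {} \<or> \<gamma> \<in> underS s (\<pi> x)} \<in> V)"
proof -
  interpret w: wo_rel s using s by (simp add: wo_rel_def)
  have V: "ultrafilter_on (Field s) V" using P unfolding p_point_def by blast
  show ?thesis
  proof (cases "nonprincipal_on (Field s) V")
    case False
    then obtain c where c: "c \<in> Field s" "{c} \<in> V" unfolding nonprincipal_on_def by blast
    then have "Field s \<noteq> {}" by blast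
    with Well_order_least[OF s] obtain z where z: "z \<in> Field s" "underS s z = {}" by blast
    have "bounded_in s (lower_part s (\<lambda>_. z) {c} \<xi>)" for \<xi>
      using c(1) w.REFL unfolding bounded_in_def lower_part_def refl_on_def by blast
    then show ?thesis
      using z c uf_carrier[OF V] unfolding diagonal_closed_def
      by (intro exI[of _ "\<lambda>_. z"] exI[of _ "{c}"]) (simp add: image_subset_iff)
  next
    case np: True
    let ?Q = "{f. f ` Field s \<subseteq> Field s \<and> \<not> constant_mod s V f}"
    \<comment> \<open>By nonprincipality \<open>id\<close> lies in \<open>?Q\<close>, so a minimal
      element exists.\<close>
    have "{x \<in> Field s. id x = c} = {c}" if "c \<in> Field s" for c using that by auto
    then have "id \<in> ?Q"
      using np unfolding constant_mod_def nonprincipal_on_def by auto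
    from wf_less_mod_ultrafilter[OF s V C unctbl[rule_format, OF np], unfolded wf_eq_minimal, rule_format, OF this]
    obtain \<pi> where \<pi>: "\<pi> \<in> ?Q"
      and min: "\<forall>f. (f, \<pi>) \<in> {(f, g). {x \<in> Field s. f x \<in> underS s (g x)} \<in> V} \<longrightarrow> f \<notin> ?Q"
      by (rule bexE)
    have min: "constant_mod s V f"
      if "{x \<in> Field s. f x \<in> underS s (\<pi> x)} \<in> V" "f ` Field s \<subseteq> Field s" for f
      using min[rule_format, of f] that by simp
    have \<pi>: "\<pi> ` Field s \<subseteq> Field s" "\<not> constant_mod s V \<pi>" using \<pi> by auto
    obtain X where X: "X \<in> V" "\<And>\<gamma>. \<gamma> \<in> Field s \<Longrightarrow> bounded_in s {x \<in> X. \<pi> x \<in> underS s \<gamma>}"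
      using P[unfolded p_point_def, THEN conjunct2, rule_format, OF conjI, OF \<pi>] by blast
    show ?thesis
    proof (intro exI conjI ballI)
      show "\<pi> ` Field s \<subseteq> Field s" "X \<in> V" by (rule \<pi>(1), rule X(1))
    next
      fix \<xi> assume \<xi>: "\<xi> \<in> Field s"
      \<comment> \<open>The p-point property bounds preimages of strict segments, while
        \<open>lower_part\<close> is nonstrict; a larger \<xi>' bridges the gap.\<close>
      obtain \<xi>' where \<xi>': "\<xi>' \<in> Field s" "\<xi> \<in> underS s \<xi>'"
        using complete_nonprincipal_no_max[OF s V np C \<xi>] by blast
      have under: "y \<in> underS s \<xi>'" if "(y, \<xi>) \<in> s" for y
        using that \<xi>'(2) w.TRANS w.ANTISYM unfolding underS_def trans_def antisym_def by blast
      show "bounded_in s (lower_part s \<pi> X \<xi>)"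
        using X(2)[OF \<xi>'(1)] under unfolding bounded_in_def lower_part_def by blast
      \<comment> \<open>Each single value below \<xi>' is avoided almost everywhere; completeness
        avoids them all at once, so \<pi> exceeds \<xi>.\<close>
      have "{x \<in> Field s. \<forall>y\<in>underS s \<xi>'. \<pi> x \<noteq> y} \<in> V"
      proof (rule uf_Ball[OF V C card_underS_less[OF s \<xi>'(1)]])
        fix y assume "y \<in> underS s \<xi>'"
        then have "y \<in> Field s" by (auto simp: underS_def Field_def)
        then show "{x \<in> Field s. \<pi> x \<noteq> y} \<in> V"
          using \<pi>(2) uf_not[OF V, of "\<lambda>x. \<pi> x = y"] unfolding constant_mod_def by simp
      qed
      then show "{x \<in> Field s. underS s (\<pi> x) = {} \<or> \<xi> \<in> underS s (\<pi> x)} \<in> V"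
        by (rule uf_mono[OF V])
          (use \<pi>(1) under underS_iff[OF s \<xi>] in \<open>auto simp: image_subset_iff\<close>)
    next
      show "diagonal_closed s \<pi> (Field s) V"
        unfolding diagonal_closed_def
      proof (intro allI impI, rule ccontr)
        fix B assume B: "\<forall>\<xi>\<in>Field s. B \<xi> \<in> V"
          and "{x \<in> Field s. \<forall>\<xi>\<in>underS s (\<pi> x). x \<in> B \<xi>} \<notin> V"
        then have N: "{x \<in> Field s. \<not> (\<forall>\<xi>\<in>underS s (\<pi> x). x \<in> B \<xi>)} \<in> V"
          using uf_not[OF V, of "\<lambda>x. \<forall>\<xi>\<in>underS s (\<pi> x). x \<in> B \<xi>"] by simp
        \<comment> \<open>Choosing a failing \<xi> at each \<open>x\<close> gives a function below
          \<pi> almost everywhere; the default \<open>\<pi> x\<close> only keeps \<open>f\<close>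
          inside \<open>Field s\<close>. By minimality \<open>f\<close> has one value
          \<open>c\<close> on a set in \<open>V\<close>, almost all of which would avoid
          \<open>B c\<close>.\<close>
        define f where "f x = (if \<exists>\<xi>\<in>underS s (\<pi> x). x \<notin> B \<xi>
          then SOME \<xi>. \<xi> \<in> underS s (\<pi> x) \<and> x \<notin> B \<xi> else \<pi> x)" for x
        have f: "f x \<in> underS s (\<pi> x) \<and> x \<notin> B (f x)"
          if "\<exists>\<xi>\<in>underS s (\<pi> x). x \<notin> B \<xi>" for x
          using that someI_ex[of "\<lambda>\<xi>. \<xi> \<in> underS s (\<pi> x) \<and> x \<notin> B \<xi>"] unfolding f_def by auto
        have N': "{x \<in> Field s. f x \<in> underS s (\<pi> x) \<and> x \<notin> B (f x)} \<in> V"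
          by (rule uf_mono[OF V N]) (use f in blast)
        have "constant_mod s V f"
        proof (rule min)
          show "{x \<in> Field s. f x \<in> underS s (\<pi> x)} \<in> V"
            by (rule uf_mono[OF V N']) blast
          show "f ` Field s \<subseteq> Field s"
          proof (rule image_subsetI)
            fix x assume x: "x \<in> Field s"
            show "f x \<in> Field s"
            proof (cases "\<exists>\<xi>\<in>underS s (\<pi> x). x \<notin> B \<xi>")
              case True
              then have "f x \<in> underS s (\<pi> x)" using f by blast
              then show ?thesis by (rule underS_Field)
            next
              case False
              then have "f x = \<pi> x" unfolding f_def by simp
              then show ?thesis using \<pi>(1) x by blast
            qed
          qed
        qed
        then obtain c where c: "c \<in> Field s" "{x \<in> Field s. f x = c} \<in> V"
          unfolding constant_mod_def by blast
        have "{x \<in> Field s. x \<in> B c} \<in> V"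
          by (rule uf_mono[OF V B[rule_format, OF c(1)]])
        from uf_conj[OF V uf_conj[OF V N' c(2)] this] show False
          by (rule uf_ex[OF V]) auto
      qed
    qed
  qed
qed

text \<open>Fodor's lemma relative to \<pi>: were every value avoided almost everywhere, the
  diagonal intersection of the sets where \<open>f x \<noteq> \<xi>\<close> would keep
  \<open>f x\<close> from lying below \<open>\<pi> x\<close>.\<close>

lemma pressing_down:
  assumes U: "ultrafilter_on (Field s) U" and \<pi>: "\<pi> ` Field s \<subseteq> Field s"
    and diag: "diagonal_closed s \<pi> (Field s) U"
    and f: "{x \<in> Field s. f x \<in> underS s (\<pi> x)} \<in> U"
  shows "\<exists>c\<in>Field s. {x \<in> Field s. f x = c} \<in> U"
proof (rule ccontr)
  assume *: "\<not> ?thesis"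
  have "{x \<in> Field s. f x \<noteq> \<xi>} \<in> U" if "\<xi> \<in> Field s" for \<xi>
    using * that uf_not[OF U, of "\<lambda>x. f x = \<xi>"] by simp
  then have "{x \<in> Field s. \<forall>\<xi>\<in>underS s (\<pi> x). x \<in> {x \<in> Field s. f x \<noteq> \<xi>}} \<in> U"
    by (rule diagonal_closedD[OF diag])
  from uf_conj[OF U f this] show False
    by (rule uf_ex[OF U]) auto
qed

section \<open>The Galvin property of the sum\<close>

text \<open>Completeness for one index set, the form in which completeness of the
  \<open>V \<alpha>\<close> enters the next lemma.\<close>

definition closed_under_Ball :: "'i set \<Rightarrow> 'b set \<Rightarrow> 'b set set \<Rightarrow> bool" where
  "closed_under_Ball I D V \<longleftrightarrow> (\<forall>B. (\<forall>\<xi>\<in>I. B \<xi> \<in> V) \<longrightarrow> {\<beta> \<in> D. \<forall>\<xi>\<in>I. \<beta> \<in> B \<xi>} \<in> V)"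

text \<open>\<open>cover\<close> serves the \<xi> with \<open>\<pi>' \<alpha> \<beta>\<close> \<le>
  \<xi> < \<open>\<pi> \<alpha>\<close>: either intersections over all \<xi> below
  \<open>\<pi> \<alpha>\<close> stay in \<open>V \<alpha>\<close>, or the lower part has a bound
  below \<open>\<pi> \<alpha>\<close>, hence a regressive function of \<alpha>.\<close>

lemma sum_uf_galvin:
  assumes K: "measurable_cardinal r"
    and U: "ultrafilter_on (Field r) U" "complete_uf r U"
    and \<pi>: "\<pi> ` Field r \<subseteq> Field r" and X: "X \<in> U"
    and diag: "diagonal_closed r \<pi> (Field r) U"
    and bdd: "\<And>\<xi>. \<xi> \<in> Field r \<Longrightarrow> bounded_in r (lower_part r \<pi> X \<xi>)"
    and V: "\<And>\<alpha>. \<alpha> \<in> Field r \<Longrightarrow> ultrafilter_on (\<delta> \<alpha>) (V \<alpha>)"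
    and \<delta>: "\<And>\<alpha>. \<alpha> \<in> Field r \<Longrightarrow> \<delta> \<alpha> \<subseteq> Field r"
    and \<pi>': "\<And>\<alpha>. \<alpha> \<in> Field r \<Longrightarrow> \<pi>' \<alpha> ` \<delta> \<alpha> \<subseteq> Field r"
    and X': "\<And>\<alpha>. \<alpha> \<in> Field r \<Longrightarrow> X' \<alpha> \<in> V \<alpha>"
    and diag': "\<And>\<alpha>. \<alpha> \<in> Field r \<Longrightarrow> diagonal_closed r (\<pi>' \<alpha>) (\<delta> \<alpha>) (V \<alpha>)"
    and small: "\<And>\<alpha> \<xi>. \<alpha> \<in> Field r \<Longrightarrow> \<xi> \<in> Field r \<Longrightarrow> |lower_part r (\<pi>' \<alpha>) (X' \<alpha>) \<xi>| <o r"
    and cover: "{\<alpha> \<in> Field r. closed_under_Ball (underS r (\<pi> \<alpha>)) (\<delta> \<alpha>) (V \<alpha>) \<or>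
        (\<forall>\<xi>\<in>underS r (\<pi> \<alpha>). \<exists>\<gamma>\<in>underS r (\<pi> \<alpha>). lower_part r (\<pi>' \<alpha>) (X' \<alpha>) \<xi> \<subseteq> under r \<gamma>)} \<in> U"
  shows "galvin_property r (sum_uf r U \<delta> V)"
  unfolding galvin_property_def
proof (intro allI impI)
  fix A assume A: "\<forall>i\<in>Field (cardSuc r). A i \<in> sum_uf r U \<delta> V"
  let ?F = "Field (cardSuc r)" and ?K = "Field r"
  have r: "Card_order r" "natLeq <o r" using K unfolding measurable_cardinal_def by simp_all
  have W: "Well_order r" by (rule card_order_on_well_order_on[OF r(1)])
  define R' where "R' \<alpha> \<xi> = lower_part r (\<pi>' \<alpha>) (X' \<alpha>) \<xi>" for \<alpha> \<xi>
  define closed where "closed \<alpha> \<longleftrightarrow> closed_under_Ball (underS r (\<pi> \<alpha>)) (\<delta> \<alpha>) (V \<alpha>)" for \<alpha>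
  note cover = cover[folded R'_def closed_def] and small = small[folded R'_def]
  define sec where "sec i \<alpha> = {\<beta> \<in> \<delta> \<alpha>. (\<alpha>, \<beta>) \<in> A i}" for i \<alpha>
  have sec: "{\<alpha> \<in> ?K. sec i \<alpha> \<in> V \<alpha>} \<in> U" if "i \<in> ?F" for i
    using A that unfolding sum_uf_def sec_def by blast
  \<comment> \<open>The aim is a bound \<eta> that depends on \<xi> but not on \<alpha>.\<close>
  define good where "good \<xi> \<eta> \<alpha> \<longleftrightarrow> closed \<alpha> \<or> (\<xi> \<in> underS r (\<pi> \<alpha>) \<longrightarrow> R' \<alpha> \<xi> \<subseteq> under r \<eta>)"
    for \<xi> \<eta> \<alpha>
  have "\<exists>\<eta>\<in>?K. {\<alpha> \<in> ?K. good \<xi> \<eta> \<alpha>} \<in> U" if \<xi>: "\<xi> \<in> ?K" for \<xi>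
  proof (cases "{\<alpha> \<in> ?K. closed \<alpha> \<or> \<xi> \<notin> underS r (\<pi> \<alpha>)} \<in> U")
    case True
    have "{\<alpha> \<in> ?K. good \<xi> \<xi> \<alpha>} \<in> U"
      by (rule uf_mono[OF U(1) True]) (auto simp: good_def)
    with \<xi> show ?thesis by blast
  next
    case False
    \<comment> \<open>The chosen bound is below \<open>\<pi> \<alpha>\<close>, so
      \<open>pressing_down\<close> makes it constant almost everywhere; that constant is the uniform
      bound.\<close>
    define f where "f \<alpha> = (SOME \<gamma>. \<gamma> \<in> underS r (\<pi> \<alpha>) \<and> R' \<alpha> \<xi> \<subseteq> under r \<gamma>)" for \<alpha>
    from False have "{\<alpha> \<in> ?K. \<not> (closed \<alpha> \<or> \<xi> \<notin> underS r (\<pi> \<alpha>))} \<in> U"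
      using uf_not[OF U(1), of "\<lambda>\<alpha>. closed \<alpha> \<or> \<xi> \<notin> underS r (\<pi> \<alpha>)"] by blast
    from uf_conj[OF U(1) this cover]
    have f: "{\<alpha> \<in> ?K. f \<alpha> \<in> underS r (\<pi> \<alpha>) \<and> R' \<alpha> \<xi> \<subseteq> under r (f \<alpha>)} \<in> U"
    proof (rule uf_mono[OF U(1)])
      fix \<alpha>
      assume "\<alpha> \<in> {\<alpha> \<in> ?K. \<not> (closed \<alpha> \<or> \<xi> \<notin> underS r (\<pi> \<alpha>)) \<and> (closed \<alpha> \<or>
        (\<forall>\<xi>\<in>underS r (\<pi> \<alpha>). \<exists>\<gamma>\<in>underS r (\<pi> \<alpha>). R' \<alpha> \<xi> \<subseteq> under r \<gamma>))}"
      then have "\<exists>\<gamma>. \<gamma> \<in> underS r (\<pi> \<alpha>) \<and> R' \<alpha> \<xi> \<subseteq> under r \<gamma>" by blast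
      then show "f \<alpha> \<in> underS r (\<pi> \<alpha>) \<and> R' \<alpha> \<xi> \<subseteq> under r (f \<alpha>)"
        unfolding f_def by (rule someI_ex)
    qed
    then have "{\<alpha> \<in> ?K. f \<alpha> \<in> underS r (\<pi> \<alpha>)} \<in> U"
      by (rule uf_mono[OF U(1)]) blast
    from pressing_down[OF U(1) \<pi> diag this]
    obtain c where c: "c \<in> ?K" "{\<alpha> \<in> ?K. f \<alpha> = c} \<in> U" by blast
    have "{\<alpha> \<in> ?K. good \<xi> c \<alpha>} \<in> U"
      by (rule uf_mono[OF U(1) uf_conj[OF U(1) f c(2)]]) (auto simp: good_def)
    with c(1) show ?thesis by blast
  qed
  then obtain \<eta> where \<eta>: "\<And>\<xi>. \<xi> \<in> ?K \<Longrightarrow> \<eta> \<xi> \<in> ?K"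
    "\<And>\<xi>. \<xi> \<in> ?K \<Longrightarrow> {\<alpha> \<in> ?K. good \<xi> (\<eta> \<xi>) \<alpha>} \<in> U"
    by metis
  define R where "R \<xi> = lower_part r \<pi> X \<xi>" for \<xi>
  have XK: "X \<subseteq> ?K" using X U(1) unfolding ultrafilter_on_def by blast
  have R: "|R \<xi>| <o r" if \<xi>: "\<xi> \<in> ?K" for \<xi>
  proof -
    obtain b where "b \<in> ?K" "R \<xi> \<subseteq> under r b"
      using bdd[OF \<xi>] unfolding bounded_in_def R_def lower_part_def under_def by blast
    then show ?thesis
      using ordLeq_ordLess_trans[OF card_of_mono1 card_under_less[OF r]] by metis
  qed
  \<comment> \<open>The first two components serve the case \<open>\<pi> \<alpha> \<le> \<xi>\<close>, the third one the case \<open>\<xi> < \<pi> \<alpha>\<close>.\<close>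
  define c where "c \<xi> i = (A i \<inter> Sigma (R \<xi>) (\<lambda>\<alpha>. R' \<alpha> \<xi>), {\<alpha> \<in> R \<xi>. sec i \<alpha> \<in> V \<alpha>},
    {\<beta> \<in> under r (\<eta> \<xi>). {\<alpha> \<in> ?K. (\<alpha>, \<beta>) \<in> A i} \<in> U})" for \<xi> i
  have "|c \<xi> ` ?F| \<le>o r" if \<xi>: "\<xi> \<in> ?K" for \<xi>
  proof -
    let ?P = "Pow (Sigma (R \<xi>) (\<lambda>\<alpha>. R' \<alpha> \<xi>)) \<times> Pow (R \<xi>) \<times> Pow (under r (\<eta> \<xi>))"
    have "|?P| <o r"
    proof (intro measurable_card_Sigma[OF K] measurable_card_Pow[OF K])
      show "|R \<xi>| <o r" "|R \<xi>| <o r" by (rule R[OF \<xi>])+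
      show "|R' \<alpha> \<xi>| <o r" if "\<alpha> \<in> R \<xi>" for \<alpha>
        using small[OF _ \<xi>] that XK unfolding R_def lower_part_def by blast
      show "|under r (\<eta> \<xi>)| <o r" by (rule card_under_less[OF r \<eta>(1)[OF \<xi>]])
    qed
    moreover have "c \<xi> ` ?F \<subseteq> ?P" unfolding c_def by auto
    ultimately show ?thesis
      using ordLess_imp_ordLeq[OF ordLeq_ordLess_trans[OF card_of_mono1]] by metis
  qed
  \<comment> \<open>\<open>A i\<close> is the template to which the sets \<open>A (j \<xi>)\<close>
    are compared; the final intersection runs over the \<open>j \<xi>\<close>.\<close>
  then obtain i j where i: "i \<in> ?F" and j: "inj_on j ?K" "\<And>\<xi>. \<xi> \<in> ?K \<Longrightarrow> j \<xi> \<in> ?F"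
    "\<And>\<xi>. \<xi> \<in> ?K \<Longrightarrow> c \<xi> (j \<xi>) = c \<xi> i"
    using cardSuc_pigeonhole[OF r, of c] by blast
  have agree1: "(\<alpha>, \<beta>) \<in> A (j \<xi>) \<longleftrightarrow> (\<alpha>, \<beta>) \<in> A i"
    if "\<xi> \<in> ?K" "\<alpha> \<in> R \<xi>" "\<beta> \<in> R' \<alpha> \<xi>" for \<xi> \<alpha> \<beta>
    using j(3)[OF that(1)] that(2,3) unfolding c_def by blast
  have agree2: "sec (j \<xi>) \<alpha> \<in> V \<alpha> \<longleftrightarrow> sec i \<alpha> \<in> V \<alpha>" if "\<xi> \<in> ?K" "\<alpha> \<in> R \<xi>" for \<xi> \<alpha>
    using j(3)[OF that(1)] that(2) unfolding c_def by blast
  have agree3: "{\<alpha> \<in> ?K. (\<alpha>, \<beta>) \<in> A (j \<xi>)} \<in> U \<longleftrightarrow> {\<alpha> \<in> ?K. (\<alpha>, \<beta>) \<in> A i} \<in> U"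
    if "\<xi> \<in> ?K" "\<beta> \<in> under r (\<eta> \<xi>)" for \<xi> \<beta>
    using j(3)[OF that(1)] that(2) unfolding c_def by blast
  \<comment> \<open>The shared data tell only which columns are large. For an ultrafilter this makes
    the two columns at \<beta> equal almost everywhere, and completeness treats the fewer than
    \<kappa> columns up to \<open>\<eta> \<xi>\<close> together.\<close>
  have agree: "{\<alpha> \<in> ?K. \<forall>\<beta>\<in>under r (\<eta> \<xi>). (\<alpha>, \<beta>) \<in> A (j \<xi>) \<longleftrightarrow> (\<alpha>, \<beta>) \<in> A i} \<in> U"
    if \<xi>: "\<xi> \<in> ?K" for \<xi>
  proof (rule uf_Ball[OF U card_under_less[OF r \<eta>(1)[OF \<xi>]]])
    fix \<beta> assume \<beta>: "\<beta> \<in> under r (\<eta> \<xi>)"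
    show "{\<alpha> \<in> ?K. (\<alpha>, \<beta>) \<in> A (j \<xi>) \<longleftrightarrow> (\<alpha>, \<beta>) \<in> A i} \<in> U"
    proof (cases "{\<alpha> \<in> ?K. (\<alpha>, \<beta>) \<in> A i} \<in> U")
      case True
      from uf_conj[OF U(1) True agree3[OF \<xi> \<beta>, THEN iffD2, OF True]] show ?thesis
        by (rule uf_mono[OF U(1)]) blast
    next
      case False
      with agree3[OF \<xi> \<beta>] have "{\<alpha> \<in> ?K. (\<alpha>, \<beta>) \<notin> A (j \<xi>)} \<in> U" "{\<alpha> \<in> ?K. (\<alpha>, \<beta>) \<notin> A i} \<in> U"
        using uf_not[OF U(1), of "\<lambda>\<alpha>. (\<alpha>, \<beta>) \<in> A (j \<xi>)"]
          uf_not[OF U(1), of "\<lambda>\<alpha>. (\<alpha>, \<beta>) \<in> A i"] by simp_all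
      from uf_conj[OF U(1) this] show ?thesis
        by (rule uf_mono[OF U(1)]) blast
    qed
  qed
  let ?I = "j ` ?K"
  have "|?I| =o |?K|"
    using j(1) by (intro ordIso_symmetric[OF card_of_ordIsoI[OF inj_on_imp_bij_betw]])
  then have "|?I| =o r" by (rule ordIso_transitive[OF _ card_of_Field_ordIso[OF r(1)]])
  moreover have "(\<Inter>i\<in>?I. A i) \<in> sum_uf r U \<delta> V"
    unfolding sum_uf_def
  proof (intro CollectI conjI)
    obtain x where x: "x \<in> ?K" using uf_ex[OF U(1) agree] infinite_Field[OF r] by fastforce
    then have "A (j x) \<in> sum_uf r U \<delta> V" using A j(2) by blast
    then have "A (j x) \<subseteq> ?K \<times> ?K" unfolding sum_uf_def by blast
    with x show "(\<Inter>i\<in>?I. A i) \<subseteq> ?K \<times> ?K" by blast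
    \<comment> \<open>A diagonal intersection of these \<kappa> many sets suffices: if \<xi> is not
      below \<open>\<pi> \<alpha>\<close>, then \<alpha> lies in \<open>R \<xi>\<close> and the
      shared data apply.\<close>
    define B where "B \<xi> = {\<alpha> \<in> ?K. (sec (j \<xi>) \<alpha> \<in> V \<alpha> \<and> good \<xi> (\<eta> \<xi>) \<alpha>) \<and>
      (\<forall>\<beta>\<in>under r (\<eta> \<xi>). (\<alpha>, \<beta>) \<in> A (j \<xi>) \<longleftrightarrow> (\<alpha>, \<beta>) \<in> A i)}" for \<xi>
    have "B \<xi> \<in> U" if "\<xi> \<in> ?K" for \<xi>
      unfolding B_def by (intro uf_conj[OF U(1)] sec j(2) \<eta>(2) agree that)
    then have Z1: "{\<alpha> \<in> ?K. \<forall>\<xi>\<in>underS r (\<pi> \<alpha>). \<alpha> \<in> B \<xi>} \<in> U"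
      by (rule diagonal_closedD[OF diag])
    have Z2: "{\<alpha> \<in> ?K. \<alpha> \<in> X} \<in> U" by (rule uf_mono[OF U(1) X])
    from uf_conj[OF U(1) uf_conj[OF U(1) Z1 Z2] sec[OF i]]
    show "{\<alpha> \<in> ?K. {\<beta> \<in> \<delta> \<alpha>. (\<alpha>, \<beta>) \<in> (\<Inter>i\<in>?I. A i)} \<in> V \<alpha>} \<in> U"
    proof (rule uf_mono[OF U(1)])
      fix \<alpha>
      assume \<alpha>K: "\<alpha> \<in> ?K" and "\<alpha> \<in> {\<alpha> \<in> ?K. ((\<forall>\<xi>\<in>underS r (\<pi> \<alpha>). \<alpha> \<in> B \<xi>) \<and> \<alpha> \<in> X) \<and> sec i \<alpha> \<in> V \<alpha>}"
      then have \<alpha>: "\<And>\<xi>. \<xi> \<in> underS r (\<pi> \<alpha>) \<Longrightarrow> \<alpha> \<in> B \<xi>" "\<alpha> \<in> X" "sec i \<alpha> \<in> V \<alpha>"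
        by blast+
      have \<pi>K: "\<pi> \<alpha> \<in> ?K" using \<pi> \<alpha>K by blast
      have in_R: "\<alpha> \<in> R \<xi>" if "\<xi> \<in> ?K" "\<xi> \<notin> underS r (\<pi> \<alpha>)" for \<xi>
        using that underS_iff[OF W that(1) \<pi>K] \<alpha>(2) unfolding R_def lower_part_def by blast
      have secj: "sec (j \<xi>) \<alpha> \<in> V \<alpha>" if \<xi>: "\<xi> \<in> ?K" for \<xi>
      proof (cases "\<xi> \<in> underS r (\<pi> \<alpha>)")
        case True
        with \<alpha>(1) show ?thesis unfolding B_def by blast
      next
        case False
        with agree2[OF \<xi> in_R] \<alpha>(3) \<xi> show ?thesis by blast
      qed
      note V = V[OF \<alpha>K]
      have Y1: "{\<beta> \<in> \<delta> \<alpha>. \<forall>\<xi>\<in>underS r (\<pi>' \<alpha> \<beta>). \<beta> \<in> sec (j \<xi>) \<alpha>} \<in> V \<alpha>"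
        by (rule diagonal_closedD[OF diag'[OF \<alpha>K] secj])
      have Y2: "{\<beta> \<in> \<delta> \<alpha>. closed \<alpha> \<longrightarrow> (\<forall>\<xi>\<in>underS r (\<pi> \<alpha>). \<beta> \<in> sec (j \<xi>) \<alpha>)} \<in> V \<alpha>"
      proof (cases "closed \<alpha>")
        case True
        have "\<xi> \<in> ?K" if "\<xi> \<in> underS r (\<pi> \<alpha>)" for \<xi> using that by (rule underS_Field)
        then have "\<forall>\<xi>\<in>underS r (\<pi> \<alpha>). sec (j \<xi>) \<alpha> \<in> V \<alpha>" by (intro ballI secj)
        with True[unfolded closed_def closed_under_Ball_def, THEN spec, of "\<lambda>\<xi>. sec (j \<xi>) \<alpha>"]
        have "{\<beta> \<in> \<delta> \<alpha>. \<forall>\<xi>\<in>underS r (\<pi> \<alpha>). \<beta> \<in> sec (j \<xi>) \<alpha>} \<in> V \<alpha>"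
          by (rule mp)
        then show ?thesis by (rule uf_mono[OF V]) blast
      next
        case False
        then show ?thesis using uf_carrier[OF V] by simp
      qed
      have Y3: "{\<beta> \<in> \<delta> \<alpha>. \<beta> \<in> X' \<alpha>} \<in> V \<alpha>" by (rule uf_mono[OF V X'[OF \<alpha>K]])
      have Y4: "{\<beta> \<in> \<delta> \<alpha>. \<beta> \<in> sec i \<alpha>} \<in> V \<alpha>" by (rule uf_mono[OF V \<alpha>(3)])
      from uf_conj[OF V uf_conj[OF V uf_conj[OF V Y1 Y2] Y3] Y4]
      show "{\<beta> \<in> \<delta> \<alpha>. (\<alpha>, \<beta>) \<in> (\<Inter>i\<in>?I. A i)} \<in> V \<alpha>"
      proof (rule uf_mono[OF V])
        fix \<beta> assume \<beta>D: "\<beta> \<in> \<delta> \<alpha>"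
          and "\<beta> \<in> {\<beta> \<in> \<delta> \<alpha>. (((\<forall>\<xi>\<in>underS r (\<pi>' \<alpha> \<beta>). \<beta> \<in> sec (j \<xi>) \<alpha>) \<and>
            (closed \<alpha> \<longrightarrow> (\<forall>\<xi>\<in>underS r (\<pi> \<alpha>). \<beta> \<in> sec (j \<xi>) \<alpha>))) \<and> \<beta> \<in> X' \<alpha>) \<and> \<beta> \<in> sec i \<alpha>}"
        then have \<beta>: "\<And>\<xi>. \<xi> \<in> underS r (\<pi>' \<alpha> \<beta>) \<Longrightarrow> \<beta> \<in> sec (j \<xi>) \<alpha>"
          "\<And>\<xi>. closed \<alpha> \<Longrightarrow> \<xi> \<in> underS r (\<pi> \<alpha>) \<Longrightarrow> \<beta> \<in> sec (j \<xi>) \<alpha>"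
          "\<beta> \<in> X' \<alpha>" "\<beta> \<in> sec i \<alpha>"
          by blast+
        have Ai: "(\<alpha>, \<beta>) \<in> A i" using \<beta>(4) unfolding sec_def by blast
        have "(\<alpha>, \<beta>) \<in> A (j \<xi>)" if \<xi>: "\<xi> \<in> ?K" for \<xi>
        proof (cases "\<xi> \<in> underS r (\<pi>' \<alpha> \<beta>)")
          case True
          with \<beta>(1) show ?thesis unfolding sec_def by blast
        next
          case False
          have "\<pi>' \<alpha> \<beta> \<in> ?K" using \<pi>'[OF \<alpha>K] \<beta>D by blast
          with False have in_R': "\<beta> \<in> R' \<alpha> \<xi>"
            using underS_iff[OF W \<xi>] \<beta>(3) unfolding R'_def lower_part_def by blast
          show ?thesis
          proof (cases "\<xi> \<in> underS r (\<pi> \<alpha>)")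
            case True
            show ?thesis
            proof (cases "closed \<alpha>")
              case True
              with \<beta>(2) \<open>\<xi> \<in> underS r (\<pi> \<alpha>)\<close> show ?thesis unfolding sec_def by blast
            next
              \<comment> \<open>The uniform bound puts \<beta> among the columns up to
                \<open>\<eta> \<xi>\<close>, on which \<open>A (j \<xi>)\<close> and
                \<open>A i\<close> agree at \<alpha>.\<close>
              case False
              have "\<alpha> \<in> B \<xi>" by (rule \<alpha>(1)[OF True])
              then have "R' \<alpha> \<xi> \<subseteq> under r (\<eta> \<xi>)"
                and *: "\<forall>\<beta>\<in>under r (\<eta> \<xi>). (\<alpha>, \<beta>) \<in> A (j \<xi>) \<longleftrightarrow> (\<alpha>, \<beta>) \<in> A i"
                using False True unfolding B_def good_def by blast+
              then show ?thesis using in_R' Ai by blast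
            qed
          next
            case False
            with agree1[OF \<xi> in_R in_R'] \<xi> Ai show ?thesis by blast
          qed
        qed
        then show "(\<alpha>, \<beta>) \<in> (\<Inter>i\<in>?I. A i)" by blast
      qed
    qed
  qed
  ultimately show "\<exists>I\<subseteq>?F. |I| =o r \<and> (\<Inter>i\<in>I. A i) \<in> sum_uf r U \<delta> V"
    using j(2) by (intro exI[of _ ?I]) blast
qed

section \<open>Ultrafilters over initial segments\<close>

lemma ofilter_mem:
  assumes "ofilter r D" "a \<in> D" "(b, a) \<in> r"
  shows "b \<in> D"
  using assms unfolding ofilter_def under_def by blast

lemma underS_Restr_ofilter:
  assumes "ofilter r D" "a \<in> D"
  shows "underS (Restr r D) a = underS r a"
  using assms ofilter_mem[OF assms] unfolding underS_def by blast

text \<open>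
  If \<open>D\<close> is countable then \<open>V\<close> may be a nonprincipal ultrafilter over \<open>\<omega>\<close>, where a least nonconstant
  function need not exist; a constant \<open>p\<close> serves there, at the price of the last conjunct.
\<close>
lemma segment_projection:
  assumes K: "measurable_cardinal r" and D: "ofilter r D"
    and P: "p_point (Restr r D) V" and C: "complete_uf (Restr r D) V"
  shows "\<exists>p Y. p ` D \<subseteq> Field r \<and> Y \<in> V \<and>
    diagonal_closed r p D V \<and>
    (\<forall>\<xi>\<in>Field r. |lower_part r p Y \<xi>| <o r) \<and>
    (natLeq <o Restr r D \<longrightarrow> (\<forall>\<xi>\<in>D. \<exists>\<gamma>\<in>D. lower_part r p Y \<xi> \<subseteq> under r \<gamma>))"
proof -
  have r: "Card_order r" "natLeq <o r" using K unfolding measurable_cardinal_def by simp_all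
  have W: "Well_order r" by (rule card_order_on_well_order_on[OF r(1)])
  have Ws: "Well_order (Restr r D)" by (rule Well_order_Restr[OF W])
  have F: "Field (Restr r D) = D" by (rule Field_Restr_ofilter[OF W D])
  have DK: "D \<subseteq> Field r" using D unfolding ofilter_def by blast
  have V: "ultrafilter_on D V" using P F unfolding p_point_def by simp
  show ?thesis
  proof (cases "nonprincipal_on D V \<longrightarrow> natLeq <o Restr r D")
    case True
    then have "nonprincipal_on (Field (Restr r D)) V \<longrightarrow> natLeq <o Restr r D" unfolding F .
    from p_point_projection[OF Ws P C this, unfolded F]
    obtain p Y where p: "p ` D \<subseteq> D" and Y: "Y \<in> V" and diag: "diagonal_closed (Restr r D) p D V"
      and bdd: "\<forall>\<xi>\<in>D. bounded_in (Restr r D) (lower_part (Restr r D) p Y \<xi>)"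
      by (elim exE conjE)
    have YD: "Y \<subseteq> D" using Y V unfolding ultrafilter_on_def by blast
    have bound: "\<exists>\<gamma>\<in>D. lower_part r p Y \<xi> \<subseteq> under r \<gamma>" if \<xi>: "\<xi> \<in> D" for \<xi>
    proof -
      obtain b where b: "b \<in> D" "\<forall>y\<in>{x \<in> Y. (p x, \<xi>) \<in> Restr r D}. (y, b) \<in> Restr r D"
        using bdd \<xi> unfolding bounded_in_def F lower_part_def by blast
      have "lower_part r p Y \<xi> \<subseteq> under r b"
      proof
        fix y assume y: "y \<in> lower_part r p Y \<xi>"
        then have "p y \<in> D" using p YD unfolding lower_part_def by blast
        then show "y \<in> under r b"
          using y b(2) \<xi> unfolding lower_part_def under_def by blast
      qed
      with b(1) show ?thesis by blast
    qed
    show ?thesis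
    proof (intro exI conjI allI impI ballI)
      show "p ` D \<subseteq> Field r" using p DK by blast
      show "Y \<in> V" by (rule Y)
    next
      show "diagonal_closed r p D V"
        unfolding diagonal_closed_def
      proof (intro allI impI)
        fix B assume B: "\<forall>\<xi>\<in>Field r. B \<xi> \<in> V"
        have "B \<xi> \<in> V" if "\<xi> \<in> Field (Restr r D)" for \<xi>
          using B DK that unfolding F by blast
        then have "{x \<in> D. \<forall>\<xi>\<in>underS (Restr r D) (p x). x \<in> B \<xi>} \<in> V"
          by (rule diagonal_closedD[OF diag])
        then show "{x \<in> D. \<forall>\<xi>\<in>underS r (p x). x \<in> B \<xi>} \<in> V"
        proof (rule uf_mono[OF V])
          fix x assume x: "x \<in> D" "x \<in> {x \<in> D. \<forall>\<xi>\<in>underS (Restr r D) (p x). x \<in> B \<xi>}"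
          then have "p x \<in> D" using p by blast
          with x(2) show "\<forall>\<xi>\<in>underS r (p x). x \<in> B \<xi>" by (simp add: underS_Restr_ofilter[OF D])
        qed
      qed
    next
      fix \<xi> assume "\<xi> \<in> D"
      then show "\<exists>\<gamma>\<in>D. lower_part r p Y \<xi> \<subseteq> under r \<gamma>" by (rule bound)
    next
      fix \<xi> assume \<xi>: "\<xi> \<in> Field r"
      \<comment> \<open>If \<open>D\<close> is all of \<kappa>, the lower part is bounded in
        \<kappa>; otherwise \<open>D\<close> itself is a proper segment, hence small.\<close>
      obtain Z where Z: "lower_part r p Y \<xi> \<subseteq> Z" "|Z| <o r"
      proof (cases "D = Field r")
        case True
        then obtain b where "b \<in> Field r" "lower_part r p Y \<xi> \<subseteq> under r b"
          using bound \<xi> by blast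
        then show ?thesis using that card_under_less[OF r] by blast
      next
        case False
        then obtain a where "a \<in> Field r" "D = underS r a"
          using D W wo_rel.ofilter_underS_Field[of r D] unfolding wo_rel_def by blast
        moreover have "lower_part r p Y \<xi> \<subseteq> D" using YD unfolding lower_part_def by blast
        ultimately show ?thesis using that card_of_underS[OF r(1)] by blast
      qed
      show "|lower_part r p Y \<xi>| <o r"
        by (rule ordLeq_ordLess_trans[OF card_of_mono1[OF Z(1)] Z(2)])
    qed
  next
    case False
    then have ctbl: "\<not> natLeq <o Restr r D" by blast
    \<comment> \<open>As \<open>D\<close> is countable, a constant \<open>p\<close> is harmless:
      even \<open>D\<close> as a lower part is smaller than \<kappa>.\<close>
    then have le: "Restr r D \<le>o natLeq"
      using not_ordLess_iff_ordLeq[OF Ws natLeq_Well_order] by blast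
    have "D \<noteq> {}" using V unfolding ultrafilter_on_def by blast
    with DK have "Field r \<noteq> {}" by blast
    with Well_order_least[OF W] obtain z where z: "z \<in> Field r" "underS r z = {}" by blast
    show ?thesis
    proof (intro exI[of _ "\<lambda>_. z"] exI[of _ D] conjI allI impI ballI)
      show "(\<lambda>_. z) ` D \<subseteq> Field r" using z(1) by blast
      show "D \<in> V" by (rule uf_carrier[OF V])
      show "diagonal_closed r (\<lambda>_. z) D V"
        using uf_carrier[OF V] z(2) unfolding diagonal_closed_def by simp
    next
      fix \<xi>
      have 1: "|lower_part r (\<lambda>_. z) D \<xi>| \<le>o |D|"
        by (rule card_of_mono1) (auto simp: lower_part_def)
      have 2: "|D| \<le>o Restr r D" by (rule card_of_least) (use Ws F in simp)
      show "|lower_part r (\<lambda>_. z) D \<xi>| <o r"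
        by (rule ordLeq_ordLess_trans[OF ordLeq_transitive[OF ordLeq_transitive[OF 1 2] le] r(2)])
    next
      assume "natLeq <o Restr r D"
      with ctbl show "\<exists>\<gamma>\<in>D. lower_part r (\<lambda>_. z) D \<xi> \<subseteq> under r \<gamma>" for \<xi> by blast
    qed
  qed
qed

section \<open>Rudin-Keisler transfer and conclusion\<close>

text \<open>Preimages commute with intersections. \<open>Field r \<noteq> {}\<close> makes the index
  set nonempty, which keeps the intersection inside \<open>T\<close>.\<close>

lemma galvin_property_rk_le:
  assumes r: "Field r \<noteq> {}" and G: "galvin_property r Z" and le: "rk_le T W S Z"
  shows "galvin_property r W"
  unfolding galvin_property_def
proof (intro allI impI)
  fix A assume A: "\<forall>i\<in>Field (cardSuc r). A i \<in> W"
  obtain \<pi> where \<pi>: "W = {B. B \<subseteq> T \<and> {t \<in> S. \<pi> t \<in> B} \<in> Z}"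
    using le unfolding rk_le_def by blast
  have "\<forall>i\<in>Field (cardSuc r). {t \<in> S. \<pi> t \<in> A i} \<in> Z" using A \<pi> by blast
  then obtain I where I: "I \<subseteq> Field (cardSuc r)" "|I| =o r"
    and Z: "(\<Inter>i\<in>I. {t \<in> S. \<pi> t \<in> A i}) \<in> Z"
    using G[unfolded galvin_property_def, rule_format, of "\<lambda>i. {t \<in> S. \<pi> t \<in> A i}"] by blast
  have "I \<noteq> {}"
    using r I(2) unfolding ordIso_def iso_def by (auto simp: bij_betw_def Field_card_of)
  then obtain i where i: "i \<in> I" by blast
  then have "(\<Inter>i\<in>I. {t \<in> S. \<pi> t \<in> A i}) = {t \<in> S. \<pi> t \<in> (\<Inter>i\<in>I. A i)}" by blast
  moreover have "(\<Inter>i\<in>I. A i) \<subseteq> T" using i I(1) A \<pi> by blast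
  ultimately have "(\<Inter>i\<in>I. A i) \<in> W" using Z \<pi> by simp
  with I show "\<exists>I\<subseteq>Field (cardSuc r). |I| =o r \<and> (\<Inter>i\<in>I. A i) \<in> W" by blast
qed

theorem theorem2p11:
  fixes r :: "'a rel"
    and U :: "'a set set"
    and \<delta> :: "'a \<Rightarrow> 'a set"
    and V :: "'a \<Rightarrow> 'a set set"
    and T :: "'b set"
    and W :: "'b set set"
  assumes "measurable_cardinal r"
    and "p_point r U" and "complete_uf r U"
    and "\<And>\<alpha>. \<alpha> \<in> Field r \<Longrightarrow> ofilter r (\<delta> \<alpha>)"
    and "\<And>\<alpha>. \<alpha> \<in> Field r \<Longrightarrow> p_point (Restr r (\<delta> \<alpha>)) (V \<alpha>)"
    and "\<And>\<alpha>. \<alpha> \<in> Field r \<Longrightarrow> complete_uf (Restr r (\<delta> \<alpha>)) (V \<alpha>)"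
    and "ultrafilter_on T W"
    and "rk_equiv T W (Field r \<times> Field r) (sum_uf r U \<delta> V)"
  shows "galvin_property r W"
proof -
  let ?K = "Field r"
  note K = assms(1) and \<delta> = assms(4)
  have r: "Card_order r" "natLeq <o r" using K unfolding measurable_cardinal_def by simp_all
  have Wr: "Well_order r" by (rule card_order_on_well_order_on[OF r(1)])
  have U: "ultrafilter_on ?K U" using assms(2) unfolding p_point_def by blast
  have FD: "Field (Restr r (\<delta> \<alpha>)) = \<delta> \<alpha>" if "\<alpha> \<in> ?K" for \<alpha>
    by (rule Field_Restr_ofilter[OF Wr \<delta>[OF that]])
  have V: "ultrafilter_on (\<delta> \<alpha>) (V \<alpha>)" if "\<alpha> \<in> ?K" for \<alpha>
    using assms(5)[OF that] FD[OF that] unfolding p_point_def by simp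
  have \<delta>K: "\<delta> \<alpha> \<subseteq> ?K" if "\<alpha> \<in> ?K" for \<alpha>
    using \<delta>[OF that] unfolding ofilter_def by blast
  obtain \<pi> X where \<pi>: "\<pi> ` ?K \<subseteq> ?K" and X: "X \<in> U"
    and diag: "diagonal_closed r \<pi> ?K U"
    and bdd: "\<forall>\<xi>\<in>?K. bounded_in r (lower_part r \<pi> X \<xi>)"
    and large: "\<forall>\<gamma>\<in>?K. {x \<in> ?K. underS r (\<pi> x) = {} \<or> \<gamma> \<in> underS r (\<pi> x)} \<in> U"
    using p_point_projection[OF Wr assms(2,3) impI[OF r(2)]] by (elim exE conjE)
  have "\<forall>\<alpha>\<in>?K. \<exists>p Y. p ` \<delta> \<alpha> \<subseteq> ?K \<and> Y \<in> V \<alpha> \<and>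
    diagonal_closed r p (\<delta> \<alpha>) (V \<alpha>) \<and>
    (\<forall>\<xi>\<in>?K. |lower_part r p Y \<xi>| <o r) \<and>
    (natLeq <o Restr r (\<delta> \<alpha>) \<longrightarrow> (\<forall>\<xi>\<in>\<delta> \<alpha>. \<exists>\<gamma>\<in>\<delta> \<alpha>. lower_part r p Y \<xi> \<subseteq> under r \<gamma>))"
    using segment_projection[OF K \<delta> assms(5,6)] by (rule ballI)
  then obtain p Y where pY: "\<forall>\<alpha>\<in>?K. p \<alpha> ` \<delta> \<alpha> \<subseteq> ?K \<and> Y \<alpha> \<in> V \<alpha> \<and>
    diagonal_closed r (p \<alpha>) (\<delta> \<alpha>) (V \<alpha>) \<and>
    (\<forall>\<xi>\<in>?K. |lower_part r (p \<alpha>) (Y \<alpha>) \<xi>| <o r) \<and>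
    (natLeq <o Restr r (\<delta> \<alpha>) \<longrightarrow>
      (\<forall>\<xi>\<in>\<delta> \<alpha>. \<exists>\<gamma>\<in>\<delta> \<alpha>. lower_part r (p \<alpha>) (Y \<alpha>) \<xi> \<subseteq> under r \<gamma>))"
    unfolding bchoice_iff by (elim exE)
  have "Well_order natLeq" by (rule natLeq_Well_order)
  \<comment> \<open>This is the ordinal \<omega> as an element of \<kappa>; by \<open>large\<close>,
    almost every \<open>\<pi> \<alpha>\<close> is least or exceeds it.\<close>
  with r(2) Wr obtain \<omega> where \<omega>: "\<omega> \<in> ?K" "natLeq =o Restr r (underS r \<omega>)"
    using ordLess_iff_ordIso_Restr by blast
  have ofS: "ofilter r (underS r a)" for a
    using Wr wo_rel.underS_ofilter[of r a] unfolding wo_rel_def by blast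
  have sum: "galvin_property r (sum_uf r U \<delta> V)"
  proof (rule sum_uf_galvin[OF K U assms(3) \<pi> X diag bdd[rule_format] V \<delta>K, where \<pi>' = p and X' = Y])
    show "{\<alpha> \<in> ?K. closed_under_Ball (underS r (\<pi> \<alpha>)) (\<delta> \<alpha>) (V \<alpha>) \<or>
        (\<forall>\<xi>\<in>underS r (\<pi> \<alpha>). \<exists>\<gamma>\<in>underS r (\<pi> \<alpha>). lower_part r (p \<alpha>) (Y \<alpha>) \<xi> \<subseteq> under r \<gamma>)} \<in> U"
    proof (rule uf_mono[OF U large[rule_format, OF \<omega>(1)]])
      fix \<alpha> assume \<alpha>: "\<alpha> \<in> ?K"
        and "\<alpha> \<in> {x \<in> ?K. underS r (\<pi> x) = {} \<or> \<omega> \<in> underS r (\<pi> x)}"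
      then have l: "underS r (\<pi> \<alpha>) = {} \<or> \<omega> \<in> underS r (\<pi> \<alpha>)" by blast
      have \<pi>\<alpha>: "\<pi> \<alpha> \<in> ?K" using \<pi> \<alpha> by blast
      show "closed_under_Ball (underS r (\<pi> \<alpha>)) (\<delta> \<alpha>) (V \<alpha>) \<or>
        (\<forall>\<xi>\<in>underS r (\<pi> \<alpha>). \<exists>\<gamma>\<in>underS r (\<pi> \<alpha>). lower_part r (p \<alpha>) (Y \<alpha>) \<xi> \<subseteq> under r \<gamma>)"
      \<comment> \<open>For \<open>\<pi> \<alpha>\<close> below the ordinal of
        \<open>\<delta> \<alpha>\<close>, completeness of \<open>V \<alpha>\<close> gives the first
        alternative; otherwise bounds are sought.\<close>
      proof (cases "\<pi> \<alpha> \<in> \<delta> \<alpha>")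
        case True
        have "underS r (\<pi> \<alpha>) \<subset> \<delta> \<alpha>"
          using True ofilter_mem[OF \<delta>[OF \<alpha>] True] unfolding underS_def by blast
        then have "Restr r (underS r (\<pi> \<alpha>)) <o Restr r (\<delta> \<alpha>)"
          using ofilter_subset_ordLess[OF Wr ofS \<delta>[OF \<alpha>]] by blast
        then have "|underS r (\<pi> \<alpha>)| <o Restr r (\<delta> \<alpha>)"
          by (rule ordLeq_ordLess_trans[OF card_underS_Restr[OF Wr]])
        then have "closed_under_Ball (underS r (\<pi> \<alpha>)) (\<delta> \<alpha>) (V \<alpha>)"
          unfolding closed_under_Ball_def
        proof (intro allI impI uf_Ball[OF V[OF \<alpha>] assms(6)[OF \<alpha>]])
          fix B \<xi> assume "\<forall>\<xi>\<in>underS r (\<pi> \<alpha>). B \<xi> \<in> V \<alpha>" "\<xi> \<in> underS r (\<pi> \<alpha>)"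
          then have "B \<xi> \<in> V \<alpha>" by blast
          then show "{\<beta> \<in> \<delta> \<alpha>. \<beta> \<in> B \<xi>} \<in> V \<alpha>" by (rule uf_mono[OF V[OF \<alpha>]])
        qed
        then show ?thesis by blast
      next
        case False
        then have sub: "\<delta> \<alpha> \<subseteq> underS r (\<pi> \<alpha>)"
          using underS_iff[OF Wr _ \<pi>\<alpha>] \<delta>K[OF \<alpha>] ofilter_mem[OF \<delta>[OF \<alpha>]] by blast
        have "\<exists>\<gamma>\<in>underS r (\<pi> \<alpha>). lower_part r (p \<alpha>) (Y \<alpha>) \<xi> \<subseteq> under r \<gamma>"
          if \<xi>: "\<xi> \<in> underS r (\<pi> \<alpha>)" for \<xi>
        \<comment> \<open>In case of equality \<xi> shows that \<open>\<pi> \<alpha>\<close> is not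
          least, so the order type of \<open>\<delta> \<alpha>\<close> exceeds \<omega> and the
          bounds of \<open>segment_projection\<close> are available. Otherwise any \<gamma> in the
          gap bounds all of \<open>\<delta> \<alpha>\<close>.\<close>
        proof (cases "\<delta> \<alpha> = underS r (\<pi> \<alpha>)")
          case True
          have \<omega>\<delta>: "\<omega> \<in> \<delta> \<alpha>" using l \<xi> True by blast
          have "underS r \<omega> \<subset> \<delta> \<alpha>"
            using \<omega>\<delta> ofilter_mem[OF \<delta>[OF \<alpha>] \<omega>\<delta>] unfolding underS_def by blast
          then have "Restr r (underS r \<omega>) <o Restr r (\<delta> \<alpha>)"
            using ofilter_subset_ordLess[OF Wr ofS \<delta>[OF \<alpha>]] by blast
          then have "natLeq <o Restr r (\<delta> \<alpha>)"
            by (rule ordIso_ordLess_trans[OF \<omega>(2)])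
          with pY \<alpha> \<xi> True show ?thesis by blast
        next
          case False
          with sub obtain \<gamma> where \<gamma>: "\<gamma> \<in> underS r (\<pi> \<alpha>)" "\<gamma> \<notin> \<delta> \<alpha>" by blast
          have \<gamma>K: "\<gamma> \<in> ?K" using \<gamma>(1) by (rule underS_Field)
          have "\<delta> \<alpha> \<subseteq> underS r \<gamma>"
            using underS_iff[OF Wr _ \<gamma>K] \<delta>K[OF \<alpha>] ofilter_mem[OF \<delta>[OF \<alpha>]] \<gamma>(2) by blast
          moreover have "lower_part r (p \<alpha>) (Y \<alpha>) \<xi> \<subseteq> \<delta> \<alpha>"
          proof -
            have "Y \<alpha> \<in> V \<alpha>" using pY \<alpha> by blast
            then have "Y \<alpha> \<subseteq> \<delta> \<alpha>" using V[OF \<alpha>] unfolding ultrafilter_on_def by blast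
            then show ?thesis unfolding lower_part_def by blast
          qed
          ultimately have "lower_part r (p \<alpha>) (Y \<alpha>) \<xi> \<subseteq> under r \<gamma>"
            unfolding underS_def under_def by blast
          with \<gamma>(1) show ?thesis by blast
        qed
        then show ?thesis by blast
      qed
    qed
  qed (use pY in simp_all)
  have "rk_le T W (?K \<times> ?K) (sum_uf r U \<delta> V)"
    using assms(8) unfolding rk_equiv_def by (rule conjunct1)
  with _ sum show ?thesis
    by (rule galvin_property_rk_le) (use \<omega>(1) in blast)
qed

end
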